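(* Let $\kappa$ be an infinite cardinal and let $\pi$ be an automorphism of $\mathcal{P}(2^\kappa)/\mathcal{I}_{\kappa^+}$ which is trivial on every subset of $2^\kappa$ of cardinality $\kappa^+$. Then $\pi$ is trivial.
   Context: $\mathcal{I}_{\kappa^+}$ is the ideal of subsets of $2^\kappa$ of cardinality at most $\kappa$, and $[A]$ is the class of $A$. $\pi$ is trivial if there is $f:2^\kappa\to 2^\kappa$ with $\pi([A])=[f^{-1}(A)]$ for all $A\subseteq 2^\kappa$; $\pi$ is trivial on $Z$ if there is $f:2^\kappa\to Z$ with $\pi([A])=[f^{-1}(A)]$ for all $A\subseteq Z$ (equivalently, $f$ may be defined on a subset whose complement lies in the ideal). *)

theory Defs
  imports Main
begin

unbundle cardinal_syntax

definition two_pow :: "'k rel \<Rightarrow> ('k \<Rightarrow> bool) set" where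
  "two_pow \<kappa> = Func (Field \<kappa>) UNIV"

lemma card_of_two_pow: "|two_pow \<kappa>| = ctwo ^c \<kappa>"
  by (simp add: two_pow_def cexp_def ctwo_def Field_card_of)

definition small_ideal :: "'k rel \<Rightarrow> ('k \<Rightarrow> bool) set set" where
  "small_ideal \<kappa> = {A. A \<subseteq> two_pow \<kappa> \<and> |A| \<le>o \<kappa>}"

definition mod_small :: "'k rel \<Rightarrow> ('k \<Rightarrow> bool) set rel" where
  "mod_small \<kappa> = {(A, B). A \<subseteq> two_pow \<kappa> \<and> B \<subseteq> two_pow \<kappa> \<and> sym_diff A B \<in> small_ideal \<kappa>}"

definition qclass :: "'k rel \<Rightarrow> ('k \<Rightarrow> bool) set \<Rightarrow> ('k \<Rightarrow> bool) set set" where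
  "qclass \<kappa> A = mod_small \<kappa> `` {A}"

definition qalg :: "'k rel \<Rightarrow> ('k \<Rightarrow> bool) set set set" where
  "qalg \<kappa> = Pow (two_pow \<kappa>) // mod_small \<kappa>"

text \<open>
  The Boolean operations of the quotient. All representatives give the same class, so each union
  below is a single class; see the lemmas \<open>qsup_qclass\<close>, \<open>qinf_qclass\<close> and \<open>qcompl_qclass\<close>.
\<close>

definition qsup :: "'k rel \<Rightarrow> ('k \<Rightarrow> bool) set set \<Rightarrow> ('k \<Rightarrow> bool) set set \<Rightarrow> ('k \<Rightarrow> bool) set set" where
  "qsup \<kappa> C D = (\<Union>A\<in>C. \<Union>B\<in>D. qclass \<kappa> (A \<union> B))"

definition qinf :: "'k rel \<Rightarrow> ('k \<Rightarrow> bool) set set \<Rightarrow> ('k \<Rightarrow> bool) set set \<Rightarrow> ('k \<Rightarrow> bool) set set" where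
  "qinf \<kappa> C D = (\<Union>A\<in>C. \<Union>B\<in>D. qclass \<kappa> (A \<inter> B))"

definition qcompl :: "'k rel \<Rightarrow> ('k \<Rightarrow> bool) set set \<Rightarrow> ('k \<Rightarrow> bool) set set" where
  "qcompl \<kappa> C = (\<Union>A\<in>C. qclass \<kappa> (two_pow \<kappa> - A))"

definition qalg_automorphism ::
  "'k rel \<Rightarrow> (('k \<Rightarrow> bool) set set \<Rightarrow> ('k \<Rightarrow> bool) set set) \<Rightarrow> bool" where
  "qalg_automorphism \<kappa> \<pi> \<longleftrightarrow>
     bij_betw \<pi> (qalg \<kappa>) (qalg \<kappa>) \<and>
     (\<forall>C\<in>qalg \<kappa>. \<forall>D\<in>qalg \<kappa>. \<pi> (qsup \<kappa> C D) = qsup \<kappa> (\<pi> C) (\<pi> D)) \<and>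
     (\<forall>C\<in>qalg \<kappa>. \<forall>D\<in>qalg \<kappa>. \<pi> (qinf \<kappa> C D) = qinf \<kappa> (\<pi> C) (\<pi> D)) \<and>
     (\<forall>C\<in>qalg \<kappa>. \<pi> (qcompl \<kappa> C) = qcompl \<kappa> (\<pi> C))"

definition trivial_aut ::
  "'k rel \<Rightarrow> (('k \<Rightarrow> bool) set set \<Rightarrow> ('k \<Rightarrow> bool) set set) \<Rightarrow> bool" where
  "trivial_aut \<kappa> \<pi> \<longleftrightarrow>
     (\<exists>f. f ` two_pow \<kappa> \<subseteq> two_pow \<kappa> \<and>
          (\<forall>A. A \<subseteq> two_pow \<kappa> \<longrightarrow> \<pi> (qclass \<kappa> A) = qclass \<kappa> (f -` A \<inter> two_pow \<kappa>)))"

text \<open>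
  Triviality on \<open>Z\<close> is witnessed by a map \<open>f : D \<rightarrow> Z\<close> with domain \<open>D\<close> contained in \<open>two_pow \<kappa>\<close>.
  The instance \<open>A = Z\<close> forces \<open>D\<close> to be a representative of \<open>\<pi> [Z]\<close>, so up to the ideal \<open>f\<close> is
  defined exactly on \<open>\<pi> [Z]\<close>. A witness with \<open>D = two_pow \<kappa>\<close> is admitted
  (\<open>trivial_on_if_total\<close>), but insisting on one would make the notion degenerate: it forces
  \<open>two_pow \<kappa> - Z\<close> into the ideal (\<open>total_witness_imp_cosmall\<close>), which is impossible for \<open>Z\<close> of
  cardinality \<open>\<kappa>\<^sup>+\<close> whenever \<open>\<kappa>\<^sup>+ < 2\<^sup>\<kappa>\<close>.
\<close>

definition trivial_on ::
  "'k rel \<Rightarrow> (('k \<Rightarrow> bool) set set \<Rightarrow> ('k \<Rightarrow> bool) set set) \<Rightarrow> ('k \<Rightarrow> bool) set \<Rightarrow> bool" where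
  "trivial_on \<kappa> \<pi> Z \<longleftrightarrow>
     (\<exists>D f. D \<subseteq> two_pow \<kappa> \<and> f ` D \<subseteq> Z \<and>
            (\<forall>A. A \<subseteq> Z \<longrightarrow> \<pi> (qclass \<kappa> A) = qclass \<kappa> (f -` A \<inter> D)))"

lemma small_ideal_Un:
  assumes "Cinfinite \<kappa>" "A \<in> small_ideal \<kappa>" "B \<in> small_ideal \<kappa>"
  shows "A \<union> B \<in> small_ideal \<kappa>"
  using assms Un_Cinfinite_bound unfolding small_ideal_def by blast

lemma small_ideal_subset:
  assumes "A \<in> small_ideal \<kappa>" "B \<subseteq> A"
  shows "B \<in> small_ideal \<kappa>"
  using assms card_of_mono1 ordLeq_transitive unfolding small_ideal_def by blast

lemma empty_in_small_ideal:
  assumes "Cinfinite \<kappa>"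
  shows "{} \<in> small_ideal \<kappa>"
  using assms by (simp add: small_ideal_def card_of_empty1)

lemma equiv_mod_small:
  assumes "Cinfinite \<kappa>"
  shows "equiv (Pow (two_pow \<kappa>)) (mod_small \<kappa>)"
proof (rule equivI)
  show "mod_small \<kappa> \<subseteq> Pow (two_pow \<kappa>) \<times> Pow (two_pow \<kappa>)"
    by (auto simp: mod_small_def)
  show "refl_on (Pow (two_pow \<kappa>)) (mod_small \<kappa>)"
    using empty_in_small_ideal[OF assms] by (auto simp: refl_on_def mod_small_def)
  show "sym (mod_small \<kappa>)"
    by (auto simp: sym_def mod_small_def Un_commute)
  show "trans (mod_small \<kappa>)"
  proof (rule transI)
    fix A B C assume *: "(A, B) \<in> mod_small \<kappa>" "(B, C) \<in> mod_small \<kappa>"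
    then have "sym_diff A B \<union> sym_diff B C \<in> small_ideal \<kappa>"
      by (simp only: mod_small_def mem_Collect_eq case_prod_conv small_ideal_Un[OF assms(1)])
    then have "sym_diff A C \<in> small_ideal \<kappa>"
      by (rule small_ideal_subset) blast
    with * show "(A, C) \<in> mod_small \<kappa>" by (auto simp: mod_small_def)
  qed
qed

lemma qclass_eq_iff:
  assumes "Cinfinite \<kappa>" "A \<subseteq> two_pow \<kappa>" "B \<subseteq> two_pow \<kappa>"
  shows "qclass \<kappa> A = qclass \<kappa> B \<longleftrightarrow> sym_diff A B \<in> small_ideal \<kappa>"
  using eq_equiv_class_iff[OF equiv_mod_small[OF assms(1)], of A B] assms
  by (auto simp: qclass_def mod_small_def)

lemma mem_qclass_iff:
  "B \<in> qclass \<kappa> A \<longleftrightarrow> A \<subseteq> two_pow \<kappa> \<and> B \<subseteq> two_pow \<kappa> \<and> sym_diff A B \<in> small_ideal \<kappa>"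
  by (auto simp: qclass_def mod_small_def)

lemma self_mem_qclass:
  assumes "Cinfinite \<kappa>" "A \<subseteq> two_pow \<kappa>"
  shows "A \<in> qclass \<kappa> A"
  using assms empty_in_small_ideal by (auto simp: mem_qclass_iff)

lemma qalg_eq: "qalg \<kappa> = qclass \<kappa> ` Pow (two_pow \<kappa>)"
  by (auto simp: qalg_def quotient_def qclass_def)

lemma qsup_qclass:
  assumes "Cinfinite \<kappa>" "A \<subseteq> two_pow \<kappa>" "B \<subseteq> two_pow \<kappa>"
  shows "qsup \<kappa> (qclass \<kappa> A) (qclass \<kappa> B) = qclass \<kappa> (A \<union> B)"
proof -
  have "qclass \<kappa> (A' \<union> B') = qclass \<kappa> (A \<union> B)"
    if *: "A' \<in> qclass \<kappa> A" "B' \<in> qclass \<kappa> B" for A' B'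
  proof -
    have "sym_diff A A' \<union> sym_diff B B' \<in> small_ideal \<kappa>"
      using * by (simp only: mem_qclass_iff mem_Collect_eq case_prod_conv small_ideal_Un[OF assms(1)])
    then have "sym_diff (A' \<union> B') (A \<union> B) \<in> small_ideal \<kappa>"
      by (rule small_ideal_subset) blast
    with * show ?thesis by (subst qclass_eq_iff[OF assms(1)]) (auto simp: mem_qclass_iff)
  qed
  then show ?thesis
    using self_mem_qclass[OF assms(1,2)] self_mem_qclass[OF assms(1,3)]
    unfolding qsup_def by fast
qed

lemma qinf_qclass:
  assumes "Cinfinite \<kappa>" "A \<subseteq> two_pow \<kappa>" "B \<subseteq> two_pow \<kappa>"
  shows "qinf \<kappa> (qclass \<kappa> A) (qclass \<kappa> B) = qclass \<kappa> (A \<inter> B)"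
proof -
  have "qclass \<kappa> (A' \<inter> B') = qclass \<kappa> (A \<inter> B)"
    if *: "A' \<in> qclass \<kappa> A" "B' \<in> qclass \<kappa> B" for A' B'
  proof -
    have "sym_diff A A' \<union> sym_diff B B' \<in> small_ideal \<kappa>"
      using * by (simp only: mem_qclass_iff mem_Collect_eq case_prod_conv small_ideal_Un[OF assms(1)])
    then have "sym_diff (A' \<inter> B') (A \<inter> B) \<in> small_ideal \<kappa>"
      by (rule small_ideal_subset) blast
    with * show ?thesis by (subst qclass_eq_iff[OF assms(1)]) (auto simp: mem_qclass_iff)
  qed
  then show ?thesis
    using self_mem_qclass[OF assms(1,2)] self_mem_qclass[OF assms(1,3)]
    unfolding qinf_def by fast
qed

lemma qcompl_qclass:
  assumes "Cinfinite \<kappa>" "A \<subseteq> two_pow \<kappa>"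
  shows "qcompl \<kappa> (qclass \<kappa> A) = qclass \<kappa> (two_pow \<kappa> - A)"
proof -
  have "qclass \<kappa> (two_pow \<kappa> - A') = qclass \<kappa> (two_pow \<kappa> - A)" if *: "A' \<in> qclass \<kappa> A" for A'
  proof -
    have "sym_diff A A' \<in> small_ideal \<kappa>" using * by (simp add: mem_qclass_iff)
    then have "sym_diff (two_pow \<kappa> - A') (two_pow \<kappa> - A) \<in> small_ideal \<kappa>"
      by (rule small_ideal_subset) blast
    then show ?thesis by (subst qclass_eq_iff[OF assms(1)]) auto
  qed
  then show ?thesis
    using self_mem_qclass[OF assms] unfolding qcompl_def by fast
qed

lemma trivial_on_if_total:
  assumes "f ` two_pow \<kappa> \<subseteq> Z"
    and "\<And>A. A \<subseteq> Z \<Longrightarrow> \<pi> (qclass \<kappa> A) = qclass \<kappa> (f -` A \<inter> two_pow \<kappa>)"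
  shows "trivial_on \<kappa> \<pi> Z"
  using assms unfolding trivial_on_def by blast

lemma total_witness_imp_cosmall:
  assumes \<kappa>: "Cinfinite \<kappa>" and \<pi>: "qalg_automorphism \<kappa> \<pi>" and Z: "Z \<subseteq> two_pow \<kappa>"
    and f: "f ` two_pow \<kappa> \<subseteq> Z"
    and w: "\<And>A. A \<subseteq> Z \<Longrightarrow> \<pi> (qclass \<kappa> A) = qclass \<kappa> (f -` A \<inter> two_pow \<kappa>)"
  shows "two_pow \<kappa> - Z \<in> small_ideal \<kappa>"
proof -
  let ?X = "two_pow \<kappa>"
  have bij: "bij_betw \<pi> (qalg \<kappa>) (qalg \<kappa>)"
    and sup: "\<And>C D. C \<in> qalg \<kappa> \<Longrightarrow> D \<in> qalg \<kappa> \<Longrightarrow> \<pi> (qsup \<kappa> C D) = qsup \<kappa> (\<pi> C) (\<pi> D)"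
    using \<pi> by (auto simp: qalg_automorphism_def)
  have X: "qclass \<kappa> ?X \<in> qalg \<kappa>" and ZQ: "qclass \<kappa> Z \<in> qalg \<kappa>"
    using Z by (auto simp: qalg_eq)
  have "\<pi> (qclass \<kappa> ?X) \<in> qalg \<kappa>" using bij X by (rule bij_betwE[THEN bspec])
  then obtain B where B: "B \<subseteq> ?X" "\<pi> (qclass \<kappa> ?X) = qclass \<kappa> B"
    by (auto simp: qalg_eq)
  have "f -` Z \<inter> ?X = ?X" using f by auto
  then have piZ: "\<pi> (qclass \<kappa> Z) = qclass \<kappa> ?X" using w[of Z] by simp
  have "?X \<union> Z = ?X" "B \<union> ?X = ?X" using Z B by auto
  then have "\<pi> (qclass \<kappa> ?X) = qclass \<kappa> ?X"
    using sup[OF X ZQ] qsup_qclass[OF \<kappa> order_refl Z] qsup_qclass[OF \<kappa> B(1) order_refl] B(2) piZ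
    by simp
  then have "qclass \<kappa> ?X = qclass \<kappa> Z"
    using bij X ZQ piZ by (metis bij_betw_imp_inj_on inj_onD)
  then have "sym_diff ?X Z \<in> small_ideal \<kappa>"
    using qclass_eq_iff[OF \<kappa> order_refl Z] by simp
  then show ?thesis by (rule small_ideal_subset) blast
qed

end

theory Submission
  imports Defs
begin

text \<open>
  For every coordinate \<open>\<xi>\<close> pick a representative \<open>B \<xi>\<close> of the image of \<open>{x. x \<xi>}\<close> and let \<open>f y\<close> be
  the point whose \<open>\<xi>\<close>-th coordinate says whether \<open>y \<in> B \<xi>\<close>. Any map witnessing triviality on a set
  \<open>Z\<close> agrees with \<open>f\<close> at each coordinate off a small set, hence agrees with \<open>f\<close> off a small set, since
  there are only \<open>\<kappa>\<close> coordinates. If some representative \<open>E\<close> of \<open>\<pi> [A]\<close> had a large part outside the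
  preimage of \<open>A\<close>, then below \<open>A\<close> and the inverse image of that part there would be a set of
  cardinality \<open>\<kappa>\<^sup>+\<close> on which \<open>\<pi>\<close> is not given by \<open>f\<close>. The other inclusion is the same statement for
  complements.
\<close>

text \<open>A cardinal above \<kappa> is at least the successor of \<kappa>, and a set has subsets
  of every cardinality up to its own. This cuts large sets down to the size at which local
  triviality is assumed.\<close>

lemma obtain_subset_card_cardSuc:
  assumes "Cinfinite \<kappa>" and "\<not> |Z| \<le>o \<kappa>"
  obtains Z' where "Z' \<subseteq> Z" "|Z'| =o cardSuc \<kappa>"
proof -
  have co: "Card_order \<kappa>"
    using assms(1) by simp
  have "\<kappa> <o |Z|"
    using assms(2) co not_ordLeq_iff_ordLess[of \<kappa> "|Z|"]
    by (simp add: card_order_on_well_order_on card_of_Well_order)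
  then have "cardSuc \<kappa> \<le>o |Z|"
    using co card_of_Card_order cardSuc_least by blast
  moreover have F: "|Field (cardSuc \<kappa>)| =o cardSuc \<kappa>"
    using co by (simp add: card_of_Field_ordIso cardSuc_Card_order)
  ultimately have "|Field (cardSuc \<kappa>)| \<le>o |Z|"
    using ordIso_ordLeq_trans by blast
  then obtain Z' where "Z' \<subseteq> Z" "|Field (cardSuc \<kappa>)| =o |Z'|"
    using internalize_card_of_ordLeq2 by blast
  then show thesis
    using that F ordIso_symmetric ordIso_transitive by blast
qed

text \<open>Closure under \<kappa> many unions is what allows the exceptional sets of all
  coordinates to be discarded at once.\<close>

lemma small_ideal_UN:
  assumes "Cinfinite \<kappa>" and "\<And>i. i \<in> Field \<kappa> \<Longrightarrow> S i \<in> small_ideal \<kappa>"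
  shows "(\<Union>i\<in>Field \<kappa>. S i) \<in> small_ideal \<kappa>"
proof -
  have "|Field \<kappa>| \<le>o \<kappa>"
    using assms(1) card_of_Field_ordIso ordIso_imp_ordLeq by blast
  then have "|\<Union>i\<in>Field \<kappa>. S i| \<le>o \<kappa>"
    using assms by (intro UNION_Cinfinite_bound) (auto simp: small_ideal_def)
  with assms(2) show ?thesis
    by (auto simp: small_ideal_def)
qed

lemma qalg_automorphism_representative:
  assumes "qalg_automorphism \<kappa> \<pi>" "A \<subseteq> two_pow \<kappa>"
  obtains B where "B \<subseteq> two_pow \<kappa>" "\<pi> (qclass \<kappa> A) = qclass \<kappa> B"
proof -
  have "\<pi> (qclass \<kappa> A) \<in> qalg \<kappa>"
    using assms bij_betwE[of \<pi> "qalg \<kappa>" "qalg \<kappa>"] by (simp add: qalg_automorphism_def qalg_eq)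
  then show thesis
    using that by (auto simp: qalg_eq)
qed

lemma qalg_automorphism_preimage:
  assumes "qalg_automorphism \<kappa> \<pi>" "B \<subseteq> two_pow \<kappa>"
  obtains A where "A \<subseteq> two_pow \<kappa>" "\<pi> (qclass \<kappa> A) = qclass \<kappa> B"
proof -
  have "qclass \<kappa> B \<in> \<pi> ` qalg \<kappa>"
    using assms by (auto simp: qalg_automorphism_def bij_betw_def qalg_eq)
  then show thesis
    using that by (auto simp: qalg_eq)
qed

lemma qalg_automorphism_inj:
  assumes "qalg_automorphism \<kappa> \<pi>" "A \<subseteq> two_pow \<kappa>" "B \<subseteq> two_pow \<kappa>"
    and "\<pi> (qclass \<kappa> A) = \<pi> (qclass \<kappa> B)"
  shows "qclass \<kappa> A = qclass \<kappa> B"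
proof -
  have "inj_on \<pi> (qalg \<kappa>)"
    using assms(1) by (simp add: qalg_automorphism_def bij_betw_def)
  moreover have "qclass \<kappa> A \<in> qalg \<kappa>" "qclass \<kappa> B \<in> qalg \<kappa>"
    using assms(2,3) by (auto simp: qalg_eq)
  ultimately show ?thesis
    using assms(4) by (simp add: inj_on_eq_iff)
qed

lemma qalg_automorphism_Int:
  assumes "Cinfinite \<kappa>" "qalg_automorphism \<kappa> \<pi>"
    and "A \<subseteq> two_pow \<kappa>" "B \<subseteq> two_pow \<kappa>" "A' \<subseteq> two_pow \<kappa>" "B' \<subseteq> two_pow \<kappa>"
    and "\<pi> (qclass \<kappa> A) = qclass \<kappa> A'" "\<pi> (qclass \<kappa> B) = qclass \<kappa> B'"
  shows "\<pi> (qclass \<kappa> (A \<inter> B)) = qclass \<kappa> (A' \<inter> B')"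
proof -
  have "qclass \<kappa> A \<in> qalg \<kappa>" "qclass \<kappa> B \<in> qalg \<kappa>"
    using assms(3,4) by (auto simp: qalg_eq)
  then have "\<pi> (qinf \<kappa> (qclass \<kappa> A) (qclass \<kappa> B)) = qinf \<kappa> (\<pi> (qclass \<kappa> A)) (\<pi> (qclass \<kappa> B))"
    using assms(2) by (simp add: qalg_automorphism_def)
  then show ?thesis
    using assms by (simp add: qinf_qclass)
qed

lemma qalg_automorphism_Compl:
  assumes "Cinfinite \<kappa>" "qalg_automorphism \<kappa> \<pi>"
    and "A \<subseteq> two_pow \<kappa>" "A' \<subseteq> two_pow \<kappa>" "\<pi> (qclass \<kappa> A) = qclass \<kappa> A'"
  shows "\<pi> (qclass \<kappa> (two_pow \<kappa> - A)) = qclass \<kappa> (two_pow \<kappa> - A')"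
proof -
  have "qclass \<kappa> A \<in> qalg \<kappa>"
    using assms(3) by (auto simp: qalg_eq)
  then have "\<pi> (qcompl \<kappa> (qclass \<kappa> A)) = qcompl \<kappa> (\<pi> (qclass \<kappa> A))"
    using assms(2) by (simp add: qalg_automorphism_def)
  then show ?thesis
    using assms by (simp add: qcompl_qclass)
qed

lemma qclass_eq_empty_iff:
  assumes "Cinfinite \<kappa>" "A \<subseteq> two_pow \<kappa>"
  shows "qclass \<kappa> A = qclass \<kappa> {} \<longleftrightarrow> A \<in> small_ideal \<kappa>"
  using qclass_eq_iff[OF assms, of "{}"] by simp

lemma qalg_automorphism_small_iff:
  assumes "Cinfinite \<kappa>" "qalg_automorphism \<kappa> \<pi>"
    and "A \<subseteq> two_pow \<kappa>" "A' \<subseteq> two_pow \<kappa>" "\<pi> (qclass \<kappa> A) = qclass \<kappa> A'"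
  shows "A' \<in> small_ideal \<kappa> \<longleftrightarrow> A \<in> small_ideal \<kappa>"
proof -
  \<comment> \<open>The zero class is the meet of a class with its complement, so it is fixed;
    injectivity then lets no other class be sent to it.\<close>
  have "\<pi> (qclass \<kappa> (A \<inter> (two_pow \<kappa> - A))) = qclass \<kappa> (A' \<inter> (two_pow \<kappa> - A'))"
    using assms by (intro qalg_automorphism_Int qalg_automorphism_Compl) auto
  then have "\<pi> (qclass \<kappa> {}) = qclass \<kappa> {}"
    by simp
  then show ?thesis
    using assms qclass_eq_empty_iff qalg_automorphism_inj[of \<kappa> \<pi> A "{}"]
    by (metis empty_subsetI)
qed

text \<open>The value \<open>undefined\<close> outside \<open>Field \<kappa>\<close> is the one that
  \<open>Func\<close> prescribes there, so all values lie in
  \<open>two_pow \<kappa>\<close>.\<close>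

definition coordinate_map :: "'k rel \<Rightarrow> ('k \<Rightarrow> ('k \<Rightarrow> bool) set) \<Rightarrow> ('k \<Rightarrow> bool) \<Rightarrow> 'k \<Rightarrow> bool" where
  "coordinate_map \<kappa> B y = (\<lambda>\<xi>. if \<xi> \<in> Field \<kappa> then y \<in> B \<xi> else undefined)"

lemma coordinate_map_in_two_pow: "coordinate_map \<kappa> B y \<in> two_pow \<kappa>"
  by (simp add: coordinate_map_def two_pow_def Func_def)

text \<open>At a coordinate \<xi>, both the \<open>g\<close>-preimage of the points of
  \<open>Z\<close> that are true at \<xi> and \<open>B \<xi> \<inter> D\<close> represent the image
  of the same meet, so they differ by a small set.\<close>

lemma local_witness_eq_coordinate_map:
  assumes \<kappa>: "Cinfinite \<kappa>" and \<pi>: "qalg_automorphism \<kappa> \<pi>"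
    and B: "\<And>\<xi>. \<xi> \<in> Field \<kappa> \<Longrightarrow> B \<xi> \<subseteq> two_pow \<kappa>"
      "\<And>\<xi>. \<xi> \<in> Field \<kappa> \<Longrightarrow> \<pi> (qclass \<kappa> {x \<in> two_pow \<kappa>. x \<xi>}) = qclass \<kappa> (B \<xi>)"
    and Z: "Z \<subseteq> two_pow \<kappa>" and D: "D \<subseteq> two_pow \<kappa>" "g ` D \<subseteq> Z"
    and g: "\<And>A. A \<subseteq> Z \<Longrightarrow> \<pi> (qclass \<kappa> A) = qclass \<kappa> (g -` A \<inter> D)"
  shows "{y \<in> D. g y \<noteq> coordinate_map \<kappa> B y} \<in> small_ideal \<kappa>"
proof -
  let ?S = "\<lambda>\<xi>. {y \<in> D. g y \<xi> \<noteq> (y \<in> B \<xi>)}"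
  have "?S \<xi> \<in> small_ideal \<kappa>" if \<xi>: "\<xi> \<in> Field \<kappa>" for \<xi>
  proof -
    let ?A = "{x \<in> two_pow \<kappa>. x \<xi>}"
    have "g -` Z \<inter> D = D"
      using D(2) by auto
    then have "\<pi> (qclass \<kappa> Z) = qclass \<kappa> D"
      using g[of Z] by simp
    then have "\<pi> (qclass \<kappa> (?A \<inter> Z)) = qclass \<kappa> (B \<xi> \<inter> D)"
      using B[OF \<xi>] D(1) Z by (intro qalg_automorphism_Int[OF \<kappa> \<pi>]) auto
    then have "qclass \<kappa> (g -` (?A \<inter> Z) \<inter> D) = qclass \<kappa> (B \<xi> \<inter> D)"
      using g[of "?A \<inter> Z"] by simp
    then have "sym_diff (g -` (?A \<inter> Z) \<inter> D) (B \<xi> \<inter> D) \<in> small_ideal \<kappa>"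
      using D(1) by (subst (asm) qclass_eq_iff[OF \<kappa>]) auto
    then show ?thesis
      using D Z by (elim small_ideal_subset) auto
  qed
  then have "(\<Union>\<xi>\<in>Field \<kappa>. ?S \<xi>) \<in> small_ideal \<kappa>"
    by (rule small_ideal_UN[OF \<kappa>])
  moreover have "{y \<in> D. g y \<noteq> coordinate_map \<kappa> B y} \<subseteq> (\<Union>\<xi>\<in>Field \<kappa>. ?S \<xi>)"
  proof
    fix y assume y: "y \<in> {y \<in> D. g y \<noteq> coordinate_map \<kappa> B y}"
    \<comment> \<open>Outside \<open>Field \<kappa>\<close> both functions are
      \<open>undefined\<close>, so a coordinate at which they differ lies in
      \<open>Field \<kappa>\<close>.\<close>
    then have "g y \<in> two_pow \<kappa>"
      using D Z by auto
    moreover obtain \<xi> where "g y \<xi> \<noteq> coordinate_map \<kappa> B y \<xi>"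
      using y by auto
    ultimately show "y \<in> (\<Union>\<xi>\<in>Field \<kappa>. ?S \<xi>)"
      using y by (auto simp: coordinate_map_def two_pow_def Func_def split: if_splits)
  qed
  ultimately show ?thesis
    by (rule small_ideal_subset)
qed

text \<open>A large difference would contain a point \<open>y\<close> at which a local witness
  agrees with the coordinate map, although the witness takes values in \<open>A\<close> and the
  coordinate map sends \<open>y\<close> outside \<open>A\<close>.\<close>

lemma image_below_coordinate_preimage:
  assumes \<kappa>: "Cinfinite \<kappa>" and \<pi>: "qalg_automorphism \<kappa> \<pi>"
    and triv: "\<And>Z. Z \<subseteq> two_pow \<kappa> \<Longrightarrow> |Z| =o cardSuc \<kappa> \<Longrightarrow> trivial_on \<kappa> \<pi> Z"
    and B: "\<And>\<xi>. \<xi> \<in> Field \<kappa> \<Longrightarrow> B \<xi> \<subseteq> two_pow \<kappa>"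
      "\<And>\<xi>. \<xi> \<in> Field \<kappa> \<Longrightarrow> \<pi> (qclass \<kappa> {x \<in> two_pow \<kappa>. x \<xi>}) = qclass \<kappa> (B \<xi>)"
    and A: "A \<subseteq> two_pow \<kappa>" and E: "E \<subseteq> two_pow \<kappa>" "\<pi> (qclass \<kappa> A) = qclass \<kappa> E"
  shows "E - coordinate_map \<kappa> B -` A \<in> small_ideal \<kappa>" (is "?W \<in> _")
proof (rule ccontr)
  assume large: "?W \<notin> small_ideal \<kappa>"
  have W: "?W \<subseteq> two_pow \<kappa>"
    using E(1) by auto
  then obtain Z0 where Z0: "Z0 \<subseteq> two_pow \<kappa>" "\<pi> (qclass \<kappa> Z0) = qclass \<kappa> ?W"
    using qalg_automorphism_preimage[OF \<pi>] by blast
  \<comment> \<open>\<open>Z0\<close> lies below \<open>A\<close> only modulo the ideal.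
    Intersecting gives a true inclusion and keeps the image class, because the difference set is
    contained in \<open>E\<close>.\<close>
  define Z where "Z = Z0 \<inter> A"
  have Z: "Z \<subseteq> two_pow \<kappa>" "Z \<subseteq> A"
    using Z0 by (auto simp: Z_def)
  have "\<pi> (qclass \<kappa> Z) = qclass \<kappa> (?W \<inter> E)"
    unfolding Z_def by (rule qalg_automorphism_Int[OF \<kappa> \<pi> Z0(1) A W E(1) Z0(2) E(2)])
  moreover have "?W \<inter> E = ?W"
    by auto
  ultimately have piZ: "\<pi> (qclass \<kappa> Z) = qclass \<kappa> ?W"
    by simp
  then have "Z \<notin> small_ideal \<kappa>"
    using large qalg_automorphism_small_iff[OF \<kappa> \<pi> Z(1) W] by simp
  then have "\<not> |Z| \<le>o \<kappa>"
    using Z(1) by (simp add: small_ideal_def)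
  then obtain Z' where Z': "Z' \<subseteq> Z" "|Z'| =o cardSuc \<kappa>"
    using obtain_subset_card_cardSuc[OF \<kappa>] by blast
  have Z'X: "Z' \<subseteq> two_pow \<kappa>"
    using Z' Z by auto
  obtain D g where D: "D \<subseteq> two_pow \<kappa>" "g ` D \<subseteq> Z'"
    and g: "\<And>A. A \<subseteq> Z' \<Longrightarrow> \<pi> (qclass \<kappa> A) = qclass \<kappa> (g -` A \<inter> D)"
    using triv[OF Z'X Z'(2)] unfolding trivial_on_def by blast
  have "g -` Z' \<inter> D = D"
    using D(2) by auto
  then have piZ': "\<pi> (qclass \<kappa> Z') = qclass \<kappa> D"
    using g[of Z'] by simp
  have "\<not> |Z'| \<le>o \<kappa>"
    using \<kappa> Z'(2) cardSuc_greater[of \<kappa>] not_ordLess_ordLeq ordIso_symmetric ordLess_ordIso_trans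
    by blast
  then have "Z' \<notin> small_ideal \<kappa>"
    by (simp add: small_ideal_def)
  then have Dlarge: "D \<notin> small_ideal \<kappa>"
    using qalg_automorphism_small_iff[OF \<kappa> \<pi> Z'X D(1) piZ'] by simp
  \<comment> \<open>As \<open>Z'\<close> lies below \<open>Z\<close>, its image \<open>D\<close>
    lies below the difference set up to a small set.\<close>
  have "Z' \<inter> Z = Z'"
    using Z'(1) by auto
  then have "qclass \<kappa> D = qclass \<kappa> (D \<inter> ?W)"
    using qalg_automorphism_Int[OF \<kappa> \<pi> Z'X Z(1) D(1) W piZ' piZ] piZ' by simp
  then have "sym_diff D (D \<inter> ?W) \<in> small_ideal \<kappa>"
    using D(1) by (subst (asm) qclass_eq_iff[OF \<kappa>]) auto
  then have "sym_diff D (D \<inter> ?W) \<union> {y \<in> D. g y \<noteq> coordinate_map \<kappa> B y} \<in> small_ideal \<kappa>"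
    using local_witness_eq_coordinate_map[OF \<kappa> \<pi> B Z'X D g] by (rule small_ideal_Un[OF \<kappa>])
  \<comment> \<open>\<open>D\<close> is large, so it is not exhausted by the two small exceptional
    sets; a remaining point gives the contradiction.\<close>
  then have "\<not> D \<subseteq> sym_diff D (D \<inter> ?W) \<union> {y \<in> D. g y \<noteq> coordinate_map \<kappa> B y}"
    using Dlarge small_ideal_subset by blast
  then obtain y where y: "y \<in> D" "y \<in> ?W" "g y = coordinate_map \<kappa> B y"
    by blast
  then have "g y \<in> A"
    using D(2) Z'(1) Z(2) by blast
  with y show False
    by simp
qed

theorem theorem3p4:
  fixes \<kappa> :: "'k rel"
    and \<pi> :: "('k \<Rightarrow> bool) set set \<Rightarrow> ('k \<Rightarrow> bool) set set"
  assumes "Cinfinite \<kappa>"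
    and "qalg_automorphism \<kappa> \<pi>"
    and "\<And>Z. Z \<subseteq> two_pow \<kappa> \<Longrightarrow> |Z| =o cardSuc \<kappa> \<Longrightarrow> trivial_on \<kappa> \<pi> Z"
  shows "trivial_aut \<kappa> \<pi>"
proof -
  have "\<exists>C. C \<subseteq> two_pow \<kappa> \<and> \<pi> (qclass \<kappa> {x \<in> two_pow \<kappa>. x \<xi>}) = qclass \<kappa> C" for \<xi>
    by (rule qalg_automorphism_representative[OF assms(2), of "{x \<in> two_pow \<kappa>. x \<xi>}"]) auto
  then have "\<exists>B. \<forall>\<xi>. B \<xi> \<subseteq> two_pow \<kappa> \<and> \<pi> (qclass \<kappa> {x \<in> two_pow \<kappa>. x \<xi>}) = qclass \<kappa> (B \<xi>)"
    by (intro choice allI)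
  then obtain B where B: "\<And>\<xi>. B \<xi> \<subseteq> two_pow \<kappa>"
    "\<And>\<xi>. \<pi> (qclass \<kappa> {x \<in> two_pow \<kappa>. x \<xi>}) = qclass \<kappa> (B \<xi>)"
    by auto
  let ?f = "coordinate_map \<kappa> B"
  have "\<pi> (qclass \<kappa> A) = qclass \<kappa> (?f -` A \<inter> two_pow \<kappa>)" if A: "A \<subseteq> two_pow \<kappa>" for A
  proof -
    obtain E where E: "E \<subseteq> two_pow \<kappa>" "\<pi> (qclass \<kappa> A) = qclass \<kappa> E"
      using qalg_automorphism_representative[OF assms(2) A] by blast
    have "E - ?f -` A \<in> small_ideal \<kappa>"
      by (rule image_below_coordinate_preimage[OF assms B A E])
    \<comment> \<open>Applied to complements, the same lemma bounds the part of the preimage of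
      \<open>A\<close> outside \<open>E\<close>: a point sent into \<open>A\<close> is not sent into
      \<open>two_pow \<kappa> - A\<close>.\<close>
    moreover have "(two_pow \<kappa> - E) - ?f -` (two_pow \<kappa> - A) \<in> small_ideal \<kappa>"
      using qalg_automorphism_Compl[OF assms(1,2) A E]
      by (intro image_below_coordinate_preimage[OF assms B]) auto
    ultimately have "(E - ?f -` A) \<union> ((two_pow \<kappa> - E) - ?f -` (two_pow \<kappa> - A)) \<in> small_ideal \<kappa>"
      by (rule small_ideal_Un[OF assms(1)])
    then have "sym_diff E (?f -` A \<inter> two_pow \<kappa>) \<in> small_ideal \<kappa>"
      by (rule small_ideal_subset) (use E(1) in auto)
    then show ?thesis
      using E by (simp add: qclass_eq_iff[OF assms(1)])
  qed
  moreover have "?f ` two_pow \<kappa> \<subseteq> two_pow \<kappa>"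
    using coordinate_map_in_two_pow by blast
  ultimately show ?thesis
    unfolding trivial_aut_def by blast
qed

end
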